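(* Let $\{p_i,\rho_i\}_{i=1}^m$ be an ensemble of linearly independent states on the $n$-dimensional Hilbert space $\mathcal{H}$ whose supports together span $\mathcal{H}$, and let $\{\Pi_i\}_{i=1}^m$ be an $m$-element POVM on $\mathcal{H}$. Put $Z=\sum_{i=1}^m p_i\rho_i\Pi_i$. Suppose that: 1. $\Pi_i\,(p_i\rho_i-p_j\rho_j)\,\Pi_j=0$ for all $1\le i,j\le m$ (equivalently, $Z=\sum_i p_i\rho_i\Pi_i=\sum_i\Pi_i p_i\rho_i$ and $(Z-p_i\rho_i)\Pi_i=0$ for all $1\le i\le m$); 2. $Z>0$ (i.e. $Z$ is Hermitian positive definite). Then $\{\Pi_i\}_{i=1}^m$ is the optimal POVM for minimum error discrimination of the ensemble $\{p_i,\rho_i\}_{i=1}^m$.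
   Context: Linearly independent ensemble: $p_i>0$, $\sum_i p_i=1$, the $\rho_i$ are density operators on the finite-dimensional complex Hilbert space $\mathcal{H}$, and the supports $\mathrm{supp}(\rho_1),\dots,\mathrm{supp}(\rho_m)$ are linearly independent subspaces which together span $\mathcal{H}$, so $\sum_i\mathrm{rank}(\rho_i)=n=\dim\mathcal{H}$. An $m$-element POVM is a family $\{\Pi_i\}_{i=1}^m$ with $\Pi_i\ge0$ and $\sum_i\Pi_i=\mathbb{1}$. It is optimal for minimum error discrimination (MED) of $\{p_i,\rho_i\}$ if it maximizes $P_s=\sum_i p_i\mathrm{Tr}(\rho_i\Pi_i)$ over all $m$-element POVMs; for linearly independent ensembles the optimal POVM is unique (known fact). *)

theory Defs
  imports "HOL-Analysis.Analysis"
begin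

text \<open>
  The \<open>n\<close>-dimensional Hilbert space is \<^typ>\<open>complex ^ 'n\<close> with its standard Hermitian inner
  product, and operators on it are matrices \<^typ>\<open>complex ^ 'n ^ 'n\<close>. The library inner product
  on \<^typ>\<open>complex ^ 'n\<close> is the real part of \<open>cinner\<close>.
\<close>

definition cinner :: "complex ^ 'n \<Rightarrow> complex ^ 'n \<Rightarrow> complex" where
  "cinner x y = (\<Sum>k\<in>UNIV. cnj (x $ k) * y $ k)"

definition adjoint_mat :: "complex ^ 'n ^ 'n \<Rightarrow> complex ^ 'n ^ 'n" where
  "adjoint_mat A = (\<chi> i j. cnj (A $ j $ i))"

definition hermitian :: "complex ^ 'n ^ 'n \<Rightarrow> bool" where
  "hermitian A \<longleftrightarrow> adjoint_mat A = A"

definition pos_semidef :: "complex ^ 'n ^ 'n \<Rightarrow> bool" where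
  "pos_semidef A \<longleftrightarrow> hermitian A \<and> (\<forall>x. 0 \<le> Re (cinner x (A *v x)))"

definition pos_def :: "complex ^ 'n ^ 'n \<Rightarrow> bool" where
  "pos_def A \<longleftrightarrow> hermitian A \<and> (\<forall>x. x \<noteq> 0 \<longrightarrow> 0 < Re (cinner x (A *v x)))"

definition density_operator :: "complex ^ 'n ^ 'n \<Rightarrow> bool" where
  "density_operator \<rho> \<longleftrightarrow> pos_semidef \<rho> \<and> trace \<rho> = 1"

text \<open>The support is the orthogonal complement of the kernel.\<close>

definition supp :: "complex ^ 'n ^ 'n \<Rightarrow> (complex ^ 'n) set" where
  "supp A = {x. \<forall>y. A *v y = 0 \<longrightarrow> cinner y x = 0}"

definition lin_indep_subspaces :: "'i set \<Rightarrow> ('i \<Rightarrow> (complex ^ 'n) set) \<Rightarrow> bool" where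
  "lin_indep_subspaces I V \<longleftrightarrow>
     (\<forall>v. (\<forall>i\<in>I. v i \<in> V i) \<longrightarrow> (\<Sum>i\<in>I. v i) = 0 \<longrightarrow> (\<forall>i\<in>I. v i = 0))"

text \<open>Families are indexed by \<open>{1..m}\<close>; their values at other indices are irrelevant.\<close>

definition ensemble :: "nat \<Rightarrow> (nat \<Rightarrow> real) \<Rightarrow> (nat \<Rightarrow> complex ^ 'n ^ 'n) \<Rightarrow> bool" where
  "ensemble m p \<rho> \<longleftrightarrow>
     (\<forall>i\<in>{1..m}. 0 < p i) \<and> (\<Sum>i=1..m. p i) = 1 \<and> (\<forall>i\<in>{1..m}. density_operator (\<rho> i))"

definition lin_indep_ensemble :: "nat \<Rightarrow> (nat \<Rightarrow> real) \<Rightarrow> (nat \<Rightarrow> complex ^ 'n ^ 'n) \<Rightarrow> bool" where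
  "lin_indep_ensemble m p \<rho> \<longleftrightarrow>
     ensemble m p \<rho> \<and>
     lin_indep_subspaces {1..m} (\<lambda>i. supp (\<rho> i)) \<and>
     vec.span (\<Union>i\<in>{1..m}. supp (\<rho> i)) = UNIV"

definition povm :: "nat \<Rightarrow> (nat \<Rightarrow> complex ^ 'n ^ 'n) \<Rightarrow> bool" where
  "povm m E \<longleftrightarrow> (\<forall>i\<in>{1..m}. pos_semidef (E i)) \<and> (\<Sum>i=1..m. E i) = mat 1"

text \<open>
  The trace of a product of two positive semidefinite matrices is real, so taking the real part
  only changes the type.
\<close>

definition success_prob ::
  "nat \<Rightarrow> (nat \<Rightarrow> real) \<Rightarrow> (nat \<Rightarrow> complex ^ 'n ^ 'n) \<Rightarrow> (nat \<Rightarrow> complex ^ 'n ^ 'n) \<Rightarrow> real" where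
  "success_prob m p \<rho> E = (\<Sum>i=1..m. p i * Re (trace (\<rho> i ** E i)))"

definition optimal_povm ::
  "nat \<Rightarrow> (nat \<Rightarrow> real) \<Rightarrow> (nat \<Rightarrow> complex ^ 'n ^ 'n) \<Rightarrow> (nat \<Rightarrow> complex ^ 'n ^ 'n) \<Rightarrow> bool" where
  "optimal_povm m p \<rho> E \<longleftrightarrow>
     povm m E \<and> (\<forall>E'. povm m E' \<longrightarrow> success_prob m p \<rho> E' \<le> success_prob m p \<rho> E)"

end

theory Submission
  imports Defs
begin

text \<open>
  Put \<open>A\<^sub>i = p\<^sub>i \<rho>\<^sub>i\<close>. Summing the first condition over one index gives
  \<open>Z \<Pi>\<^sub>i = A\<^sub>i \<Pi>\<^sub>i\<close>, hence \<open>Z y = \<Sum>\<^sub>i A\<^sub>i \<Pi>\<^sub>i y\<close> for all \<open>y\<close>. Given \<open>x\<close>, solve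
  \<open>Z y = A\<^sub>j x\<close>; since the ranges of the \<open>A\<^sub>i\<close> are independent, \<open>A\<^sub>j x = A\<^sub>j u\<close> with
  \<open>u = \<Pi>\<^sub>j y\<close>. As \<open>Z - A\<^sub>j\<close> annihilates \<open>u\<close> and \<open>A\<^sub>j\<close> annihilates \<open>k = x - u\<close>, the
  quadratic form of \<open>Z - A\<^sub>j\<close> at \<open>x\<close> equals that of \<open>Z\<close> at \<open>k\<close>, so \<open>Z - A\<^sub>j \<ge> 0\<close>.
  Any POVM \<open>\<Pi>'\<close> then loses \<open>\<Sum>\<^sub>i Tr ((Z - A\<^sub>i) \<Pi>'\<^sub>i) \<ge> 0\<close> against \<open>Tr Z\<close>. If it loses
  nothing, then \<open>Z \<Pi>'\<^sub>i = A\<^sub>i \<Pi>'\<^sub>i\<close> too, and comparing the two decompositions of \<open>Z x\<close> along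
  the independent ranges gives \<open>\<Pi>' = \<Pi>\<close>.
\<close>

section \<open>Hermitian forms and matrix algebra\<close>

lemma Re_cinner: "Re (cinner x y) = x \<bullet> y"
  by (simp add: cinner_def inner_vec_def inner_complex_def)

lemma cinner_adjoint: "cinner x (A *v y) = cinner (adjoint_mat A *v x) y"
proof -
  have "cinner x (A *v y) = (\<Sum>i\<in>UNIV. \<Sum>j\<in>UNIV. cnj (x $ i) * (A $ i $ j * y $ j))"
    by (simp add: cinner_def matrix_vector_mult_def sum_distrib_left)
  also have "\<dots> = (\<Sum>j\<in>UNIV. \<Sum>i\<in>UNIV. cnj (x $ i) * (A $ i $ j * y $ j))"
    by (rule sum.swap)
  also have "\<dots> = cinner (adjoint_mat A *v x) y"
    by (simp add: cinner_def adjoint_mat_def matrix_vector_mult_def sum_distrib_left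
        sum_distrib_right algebra_simps)
  finally show ?thesis .
qed

lemma hermitian_cinner: "hermitian A \<Longrightarrow> cinner x (A *v y) = cinner (A *v x) y"
  using cinner_adjoint[of x A y] by (simp add: hermitian_def)

lemma hermitian_inner: "hermitian A \<Longrightarrow> x \<bullet> (A *v y) = (A *v x) \<bullet> y"
  by (simp only: Re_cinner[symmetric] hermitian_cinner)

lemma hermitian_nth:
  assumes "hermitian A"
  shows "cnj (A $ i $ j) = A $ j $ i"
proof -
  have "cnj (A $ i $ j) = adjoint_mat A $ j $ i" by (simp add: adjoint_mat_def)
  then show ?thesis using assms by (simp only: hermitian_def)
qed

lemma hermitianI: "(\<And>i j. cnj (A $ i $ j) = A $ j $ i) \<Longrightarrow> hermitian A"
  by (simp add: hermitian_def adjoint_mat_def vec_eq_iff)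

lemma hermitian_diff: "hermitian A \<Longrightarrow> hermitian B \<Longrightarrow> hermitian (A - B)"
  by (rule hermitianI) (simp add: hermitian_nth)

lemma hermitian_scaleR: "hermitian A \<Longrightarrow> hermitian (c *\<^sub>R A)"
  by (rule hermitianI) (simp add: hermitian_nth)

lemma adjoint_mat_mult: "adjoint_mat (A ** B) = adjoint_mat B ** adjoint_mat A"
  by (simp add: adjoint_mat_def matrix_matrix_mult_def vec_eq_iff mult.commute)

lemma adjoint_mat_sum: "adjoint_mat (\<Sum>i\<in>I. f i) = (\<Sum>i\<in>I. adjoint_mat (f i))"
  by (simp add: adjoint_mat_def vec_eq_iff)

lemma matrix_mult_sum_left: "(\<Sum>i\<in>I. f i) ** B = (\<Sum>i\<in>I. f i ** B)"
  for f :: "'i \<Rightarrow> 'a::comm_semiring_1 ^ 'n ^ 'm" and B :: "'a ^ 'k ^ 'n"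
  by (simp add: matrix_matrix_mult_def vec_eq_iff sum_distrib_right)
    (rule allI, rule allI, rule sum.swap)

lemma matrix_mult_sum_right: "B ** (\<Sum>i\<in>I. f i) = (\<Sum>i\<in>I. B ** f i)"
  for f :: "'i \<Rightarrow> 'a::comm_semiring_1 ^ 'k ^ 'n" and B :: "'a ^ 'n ^ 'm"
  by (simp add: matrix_matrix_mult_def vec_eq_iff sum_distrib_left)
    (rule allI, rule allI, rule sum.swap)

lemma matrix_vector_mult_sum_left: "(\<Sum>i\<in>I. f i) *v x = (\<Sum>i\<in>I. f i *v x)"
  for f :: "'i \<Rightarrow> 'a::comm_semiring_1 ^ 'n ^ 'm"
  by (simp add: matrix_vector_mult_def vec_eq_iff sum_distrib_right) (rule allI, rule sum.swap)

lemma trace_sum: "trace (\<Sum>i\<in>I. f i) = (\<Sum>i\<in>I. trace (f i))"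
  by (simp add: trace_def) (rule sum.swap)

lemma trace_zero: "trace 0 = 0"
  by (simp add: trace_def)

lemma scaleR_matrix_mult: "(c *\<^sub>R A) ** B = c *\<^sub>R (A ** B)"
  for A :: "complex ^ 'n ^ 'm" and B :: "complex ^ 'k ^ 'n"
  by (simp add: matrix_matrix_mult_def vec_eq_iff scaleR_sum_right)

lemma scaleR_matrix_vector_mult: "(c *\<^sub>R A) *v x = A *v (c *\<^sub>R x)"
  for A :: "complex ^ 'n ^ 'm"
  by (simp add: matrix_vector_mult_def vec_eq_iff)

lemma complex_matrix_vector_mult_scaleR: "A *v (c *\<^sub>R x) = c *\<^sub>R (A *v x)"
  for A :: "complex ^ 'n ^ 'm"
  by (simp add: matrix_vector_mult_def vec_eq_iff scaleR_sum_right)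

lemma matrix_vector_mult_axis: "A *v axis k 1 = column k A"
  for A :: "'a::comm_semiring_1 ^ 'n ^ 'm"
  by (simp add: vec_eq_iff matrix_vector_mult_def column_def axis_def if_distrib cong: if_cong)

lemma matrix_diff_ldistrib: "A ** (B - C) = A ** B - A ** C"
  for A :: "'a::comm_ring_1 ^ 'n ^ 'm"
  by (simp add: matrix_matrix_mult_def vec_eq_iff right_diff_distrib sum_subtractf)

lemma matrix_diff_rdistrib: "(A - B) ** C = A ** C - B ** C"
  for A :: "'a::comm_ring_1 ^ 'n ^ 'm"
  by (simp add: matrix_matrix_mult_def vec_eq_iff left_diff_distrib sum_subtractf)

section \<open>Positive semidefinite matrices and Gram decompositions\<close>

text \<open>A zero of the form is a minimum. Moving from \<open>x\<close> a short way along
  \<open>-Q *v x\<close> would push the form below zero, because the first-order term is negative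
  unless \<open>Q *v x = 0\<close>.\<close>

lemma pos_semidef_form_eq_0:
  assumes Q: "pos_semidef Q" and 0: "x \<bullet> (Q *v x) = 0"
  shows "Q *v x = 0"
proof (rule ccontr)
  assume ne: "Q *v x \<noteq> 0"
  define w where "w = Q *v x"
  define c where "c = w \<bullet> (Q *v w)"
  have h: "hermitian Q" and pos: "\<And>y. 0 \<le> y \<bullet> (Q *v y)"
    using Q by (auto simp: pos_semidef_def Re_cinner)
  have form: "(x - t *\<^sub>R w) \<bullet> (Q *v (x - t *\<^sub>R w)) = t\<^sup>2 * c - 2 * t * (w \<bullet> w)" for t :: real
  proof -
    have "x \<bullet> (Q *v w) = w \<bullet> w"
      using hermitian_inner[OF h, of x w] by (simp add: w_def)
    moreover have "w \<bullet> (Q *v x) = w \<bullet> w" by (simp add: w_def)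
    ultimately show ?thesis using 0
      by (simp add: matrix_vector_mult_diff_distrib complex_matrix_vector_mult_scaleR inner_diff
          c_def power2_eq_square algebra_simps)
  qed
  have w: "w \<bullet> w > 0" using ne by (simp add: w_def)
  have c0: "c \<ge> 0" using pos by (simp add: c_def)
  \<comment> \<open>The quadratic in \<open>t\<close> has its minimum at
    \<open>(w \<bullet> w) / c\<close>; the \<open>+ 1\<close> covers \<open>c = 0\<close> and still
    leaves the value negative.\<close>
  define t where "t = (w \<bullet> w) / (c + 1)"
  have t: "t > 0" using w c0 by (simp add: t_def)
  have "t * c \<le> w \<bullet> w"
    using w c0 by (simp add: t_def field_simps)
  then have "t * (t * c) \<le> t * (w \<bullet> w)" using t by simp
  moreover have "t * (w \<bullet> w) > 0" using t w by simp
  ultimately have "t\<^sup>2 * c - 2 * t * (w \<bullet> w) < 0"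
    by (simp add: power2_eq_square algebra_simps)
  with pos[of "x - t *\<^sub>R w"] form[of t] show False by simp
qed

lemma pos_semidef_diag:
  assumes "pos_semidef P"
  obtains d where "0 \<le> d" "P $ k $ k = complex_of_real d" "d = axis k 1 \<bullet> (P *v axis k 1)"
proof
  have "P *v axis k 1 = column k P" by (rule matrix_vector_mult_axis)
  then have *: "axis k 1 \<bullet> (P *v axis k 1) = Re (P $ k $ k)"
    by (simp add: inner_axis' column_def inner_complex_def)
  show "0 \<le> Re (P $ k $ k)" using assms * by (metis pos_semidef_def Re_cinner)
  have "cnj (P $ k $ k) = P $ k $ k" using assms by (simp add: pos_semidef_def hermitian_nth)
  then show "P $ k $ k = complex_of_real (Re (P $ k $ k))"
    by (simp add: complex_eq_iff)
  show "Re (P $ k $ k) = axis k 1 \<bullet> (P *v axis k 1)" using * by simp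
qed

text \<open>
  If \<open>P $ k $ k = 0\<close>, division by zero makes the subtracted rank-one term vanish, which is right
  because then the whole column vanishes.
\<close>

lemma pos_semidef_schur_step:
  fixes P :: "complex ^ 'n ^ 'n" and k :: 'n
  assumes P: "pos_semidef P"
  defines "v \<equiv> (\<chi> i. P $ i $ k / complex_of_real (sqrt (Re (P $ k $ k))))"
  defines "P' \<equiv> (\<chi> i j. P $ i $ j - v $ i * cnj (v $ j))"
  shows "pos_semidef P'" and "P' $ k $ j = 0"
    and "P $ i $ k = 0 \<Longrightarrow> P' $ i $ j = P $ i $ j"
proof -
  obtain d where d: "0 \<le> d" "P $ k $ k = complex_of_real d" "d = axis k 1 \<bullet> (P *v axis k 1)"
    using pos_semidef_diag[OF P] by metis
  have h: "hermitian P" and pos: "\<And>y. 0 \<le> y \<bullet> (P *v y)"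
    using P by (auto simp: pos_semidef_def Re_cinner)
  have col: "P *v axis k 1 = column k P" by (rule matrix_vector_mult_axis)
  \<comment> \<open>The two square roots multiply to \<open>d\<close>, so \<open>P'\<close> is the
    Schur complement with pivot \<open>P $ k $ k\<close>, padded by a zero row and column.\<close>
  have P'ij: "P' $ i $ j = P $ i $ j - P $ i $ k * P $ k $ j / complex_of_real d" for i j
  proof -
    have "complex_of_real (sqrt d) * complex_of_real (sqrt d) = complex_of_real d"
      using d(1) by (metis of_real_mult real_sqrt_mult_self abs_of_nonneg)
    then show ?thesis
      by (simp add: P'_def v_def d(2) hermitian_nth[OF h])
  qed
  have zero: "P $ i $ k = 0" if "d = 0" for i
    using pos_semidef_form_eq_0[OF P, of "axis k 1"] d(3) that
    by (simp add: col column_def vec_eq_iff)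
  have zero': "P $ k $ i = 0" if "d = 0" for i
    using zero[OF that, of i] hermitian_nth[OF h, of i k] by simp
  show row: "P' $ k $ j = 0" for j
    using zero' by (cases "d = 0") (simp_all add: P'ij d(2))
  show "P $ i $ k = 0 \<Longrightarrow> P' $ i $ j = P $ i $ j"
    by (simp add: P'ij)
  have h': "hermitian P'"
    by (rule hermitianI) (simp add: P'ij hermitian_nth[OF h] mult.commute)
  have "0 \<le> x \<bullet> (P' *v x)" for x
  proof -
    \<comment> \<open>This \<open>c\<close> gives \<open>P' *v x = P *v y\<close>. As
      \<open>x\<close> and \<open>y\<close> differ only in coordinate \<open>k\<close>, where
      \<open>P' *v x\<close> vanishes, the form of \<open>P'\<close> at \<open>x\<close> is the form
      of \<open>P\<close> at \<open>y\<close>.\<close>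
    define c where "c = (P *v x) $ k / complex_of_real d"
    define y where "y = x - axis k c"
    have "P' *v x = P *v x - (\<chi> i. P $ i $ k * c)"
      by (simp add: vec_eq_iff matrix_vector_mult_def P'ij c_def left_diff_distrib sum_subtractf
          sum_distrib_left sum_divide_distrib mult.assoc)
    also have "(\<chi> i. P $ i $ k * c) = P *v axis k c"
      by (simp add: vec_eq_iff matrix_vector_mult_def axis_def if_distrib cong: if_cong)
    finally have eq: "P' *v x = P *v y"
      by (simp add: y_def matrix_vector_mult_diff_distrib)
    have "(P' *v x) $ k = 0"
      by (simp add: matrix_vector_mult_def row)
    then have "y \<bullet> (P' *v x) = x \<bullet> (P' *v x)"
      by (simp add: y_def inner_diff_left inner_axis')
    then show ?thesis using pos[of y] by (simp add: eq)
  qed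
  with h' show "pos_semidef P'" by (simp add: pos_semidef_def Re_cinner)
qed

text \<open>Cholesky elimination: \<open>S\<close> holds the rows not yet cleared, and each Schur
  step clears one and contributes one vector. Rows that already vanish stay zero, since their entry
  in the pivot column is zero.\<close>

lemma pos_semidef_gram_on:
  fixes P :: "complex ^ 'n ^ 'n"
  assumes "finite S" and "pos_semidef P" and "\<And>i j. i \<notin> S \<Longrightarrow> P $ i $ j = 0"
  shows "\<exists>v :: 'n \<Rightarrow> complex ^ 'n. \<forall>i j. P $ i $ j = (\<Sum>k\<in>S. v k $ i * cnj (v k $ j))"
  using assms
proof (induction S arbitrary: P rule: finite_induct)
  case empty
  then show ?case by simp
next
  case (insert k S)
  define v where "v = (\<chi> i. P $ i $ k / complex_of_real (sqrt (Re (P $ k $ k))))"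
  define P' where "P' = (\<chi> i j. P $ i $ j - v $ i * cnj (v $ j))"
  note step = pos_semidef_schur_step[where k = k, OF insert.prems(1), folded v_def, folded P'_def]
  have "P' $ i $ j = 0" if "i \<notin> S" for i j
    using that step(2) step(3)[of i j] insert.prems(2)[of i]
by (cases "i = k") auto
  from insert.IH[OF step(1) this] obtain u :: "'n \<Rightarrow> complex ^ 'n"
    where u: "\<And>i j. P' $ i $ j = (\<Sum>l\<in>S. u l $ i * cnj (u l $ j))" by auto
  have "P $ i $ j = (\<Sum>l\<in>insert k S. (u(k := v)) l $ i * cnj ((u(k := v)) l $ j))" for i j
  proof -
    have "(\<Sum>l\<in>S. (u(k := v)) l $ i * cnj ((u(k := v)) l $ j)) = P' $ i $ j"
      unfolding u using insert.hyps(2) by (intro sum.cong) auto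
    then show ?thesis
      using insert.hyps by (simp add: P'_def)
  qed
  then show ?case by blast
qed

lemma pos_semidef_gram:
  fixes P :: "complex ^ 'n ^ 'n"
  assumes "pos_semidef P"
  shows "\<exists>v :: 'n \<Rightarrow> complex ^ 'n. \<forall>i j. P $ i $ j = (\<Sum>k\<in>UNIV. v k $ i * cnj (v k $ j))"
  by (rule pos_semidef_gram_on[OF finite assms]) simp

section \<open>Traces of products of positive semidefinite matrices\<close>

lemma trace_gram_mult:
  assumes v: "\<And>i j. P $ i $ j = (\<Sum>k\<in>UNIV. v k $ i * cnj (v k $ j))"
  shows "trace (Q ** P) = (\<Sum>k\<in>UNIV. cinner (v k) (Q *v v k))"
proof -
  have "trace (Q ** P) =
      (\<Sum>i\<in>UNIV. \<Sum>j\<in>UNIV. \<Sum>k\<in>UNIV. cnj (v k $ i) * (Q $ i $ j * v k $ j))"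
    by (simp add: trace_def matrix_matrix_mult_def v sum_distrib_left algebra_simps)
  also have "\<dots> = (\<Sum>i\<in>UNIV. \<Sum>k\<in>UNIV. \<Sum>j\<in>UNIV. cnj (v k $ i) * (Q $ i $ j * v k $ j))"
    by (rule sum.cong[OF refl], rule sum.swap)
  also have "\<dots> = (\<Sum>k\<in>UNIV. \<Sum>i\<in>UNIV. \<Sum>j\<in>UNIV. cnj (v k $ i) * (Q $ i $ j * v k $ j))"
    by (rule sum.swap)
  also have "\<dots> = (\<Sum>k\<in>UNIV. cinner (v k) (Q *v v k))"
    by (simp add: cinner_def matrix_vector_mult_def sum_distrib_left)
  finally show ?thesis .
qed

lemma trace_mult_pos_semidef_nonneg:
  fixes P Q :: "complex ^ 'n ^ 'n"
  assumes "pos_semidef Q" "pos_semidef P"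
  shows "0 \<le> Re (trace (Q ** P))"
proof -
  obtain v :: "'n \<Rightarrow> complex ^ 'n"
    where "\<And>i j. P $ i $ j = (\<Sum>k\<in>UNIV. v k $ i * cnj (v k $ j))"
    using pos_semidef_gram[OF assms(2)] by blast
  then have "trace (Q ** P) = (\<Sum>k\<in>UNIV. cinner (v k) (Q *v v k))" by (rule trace_gram_mult)
  then show ?thesis
    using assms(1) by (auto simp: pos_semidef_def intro: sum_nonneg)
qed

text \<open>The trace is a sum of nonnegative values of the form of \<open>Q\<close> at the Gram
  vectors of \<open>P\<close>. If all vanish, \<open>Q\<close> kills every Gram vector, hence every
  column of \<open>P\<close>, which is a combination of them.\<close>

lemma trace_mult_pos_semidef_eq_0:
  fixes P Q :: "complex ^ 'n ^ 'n"
  assumes Q: "pos_semidef Q" and P: "pos_semidef P" and 0: "Re (trace (Q ** P)) = 0"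
  shows "Q ** P = 0"
proof -
  obtain v :: "'n \<Rightarrow> complex ^ 'n"
    where v: "\<And>i j. P $ i $ j = (\<Sum>k\<in>UNIV. v k $ i * cnj (v k $ j))"
    using pos_semidef_gram[OF P] by blast
  have pos: "\<And>x. 0 \<le> x \<bullet> (Q *v x)"
    using Q by (auto simp: pos_semidef_def Re_cinner)
  have "(\<Sum>k\<in>UNIV. v k \<bullet> (Q *v v k)) = 0"
    using 0 by (simp add: trace_gram_mult[OF v] Re_cinner)
  then have "v k \<bullet> (Q *v v k) = 0" for k
    using pos by (simp add: sum_nonneg_eq_0_iff)
  then have "Q *v v k = 0" for k
    using Q by (blast intro: pos_semidef_form_eq_0)
  then have Qv: "(\<Sum>j\<in>UNIV. Q $ i $ j * v k $ j) = 0" for i k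
    by (simp add: vec_eq_iff matrix_vector_mult_def)
  have "(Q ** P) $ i $ l = 0" for i l
  proof -
    have "(Q ** P) $ i $ l = (\<Sum>j\<in>UNIV. \<Sum>k\<in>UNIV. Q $ i $ j * v k $ j * cnj (v k $ l))"
      by (simp add: matrix_matrix_mult_def v sum_distrib_left algebra_simps)
    also have "\<dots> = (\<Sum>k\<in>UNIV. (\<Sum>j\<in>UNIV. Q $ i $ j * v k $ j) * cnj (v k $ l))"
      unfolding sum_distrib_right by (rule sum.swap)
    finally show ?thesis by (simp add: Qv)
  qed
  then show ?thesis by (simp add: vec_eq_iff)
qed

section \<open>Invertibility of \<open>Z\<close> and independence of the ranges\<close>

lemma pos_def_inj: "pos_def Z \<Longrightarrow> Z *v x = Z *v y \<Longrightarrow> x = y"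
proof (rule ccontr)
  assume Z: "pos_def Z" and eq: "Z *v x = Z *v y" and "x \<noteq> y"
  then have "0 < Re (cinner (x - y) (Z *v (x - y)))" by (simp add: pos_def_def)
  then show False using eq by (simp add: matrix_vector_mult_diff_distrib Re_cinner)
qed

lemma pos_def_surj:
  fixes Z :: "complex ^ 'n ^ 'n"
  assumes "pos_def Z"
  obtains y where "Z *v y = x"
proof -
  have "inj ((*v) Z)" using pos_def_inj[OF assms] by (auto intro: injI)
  then have "surj ((*v) Z)"
    using vec.linear_injective_imp_surjective[OF matrix_vector_mul_linear_gen] by blast
  then show ?thesis using that by (metis surj_def)
qed

lemma hermitian_scaleR_mult_in_supp: "hermitian A \<Longrightarrow> (c *\<^sub>R A) *v x \<in> supp A"
  by (simp add: supp_def scaleR_matrix_vector_mult hermitian_cinner) (simp add: cinner_def)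

text \<open>Carries independence from the supports to the ranges of the weighted states: the range
  of a Hermitian matrix lies in its support, so the differences of the summands are independent
  vectors with sum zero.\<close>

lemma lin_indep_subspaces_scaled_rangeD:
  assumes "lin_indep_subspaces I (\<lambda>i. supp (\<rho> i))" and h: "\<And>i. i \<in> I \<Longrightarrow> hermitian (\<rho> i)"
    and eq: "(\<Sum>i\<in>I. (p i *\<^sub>R \<rho> i) *v x i) = (\<Sum>i\<in>I. (p i *\<^sub>R \<rho> i) *v y i)"
    and i: "i \<in> I"
  shows "(p i *\<^sub>R \<rho> i) *v x i = (p i *\<^sub>R \<rho> i) *v y i"
proof -
  have "(\<Sum>i\<in>I. (p i *\<^sub>R \<rho> i) *v (x i - y i)) = 0"
    using eq by (simp add: matrix_vector_mult_diff_distrib sum_subtractf)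
  moreover have "\<forall>i\<in>I. (p i *\<^sub>R \<rho> i) *v (x i - y i) \<in> supp (\<rho> i)"
    using h by (simp add: hermitian_scaleR_mult_in_supp)
  ultimately have "(p i *\<^sub>R \<rho> i) *v (x i - y i) = 0"
    using assms(1)[unfolded lin_indep_subspaces_def, rule_format,
        of "\<lambda>i. (p i *\<^sub>R \<rho> i) *v (x i - y i)" i] i by blast
  then show ?thesis by (simp add: matrix_vector_mult_diff_distrib)
qed

section \<open>Optimality and uniqueness\<close>

theorem theorem3p1p2:
  fixes m :: nat
    and p :: "nat \<Rightarrow> real"
    and \<rho> E :: "nat \<Rightarrow> complex ^ 'n ^ 'n"
    and Z :: "complex ^ 'n ^ 'n"
  assumes "lin_indep_ensemble m p \<rho>"
    and "povm m E"
    and "Z = (\<Sum>i=1..m. p i *\<^sub>R (\<rho> i ** E i))"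
    and "\<forall>i\<in>{1..m}. \<forall>j\<in>{1..m}. E i ** (p i *\<^sub>R \<rho> i - p j *\<^sub>R \<rho> j) ** E j = 0"
    and "pos_def Z"
  shows "optimal_povm m p \<rho> E \<and>
         (\<forall>E'. optimal_povm m p \<rho> E' \<longrightarrow> (\<forall>i\<in>{1..m}. E' i = E i))"
proof -
  define A where "A i = p i *\<^sub>R \<rho> i" for i
  have h\<rho>: "hermitian (\<rho> i)" if "i \<in> {1..m}" for i
    using assms(1) that
    by (simp add: lin_indep_ensemble_def ensemble_def density_operator_def pos_semidef_def)
  have hA: "hermitian (A i)" if "i \<in> {1..m}" for i
    using h\<rho>[OF that] by (simp add: A_def hermitian_scaleR)
  have hZ: "hermitian Z" using assms(5) by (simp add: pos_def_def)
  have hE: "hermitian (E i)" if "i \<in> {1..m}" for i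
    using assms(2) that by (simp add: povm_def pos_semidef_def)
  have sum_E: "(\<Sum>i=1..m. E i) = mat 1" using assms(2) by (simp add: povm_def)
  have Z: "Z = (\<Sum>i=1..m. A i ** E i)"
    by (simp add: assms(3) A_def scaleR_matrix_mult)
  have indep: "A i *v x i = A i *v y i"
    if "(\<Sum>i=1..m. A i *v x i) = (\<Sum>i=1..m. A i *v y i)" "i \<in> {1..m}" for x y i
    using lin_indep_subspaces_scaled_rangeD[of "{1..m}" \<rho> p x y i] that h\<rho> assms(1)
    by (simp add: A_def lin_indep_ensemble_def)
  \<comment> \<open>Taking adjoints puts \<open>E i\<close> on the left of \<open>A i\<close>, so
    that \<open>Z ** E j\<close> becomes a sum of the products occurring in the hypothesis.\<close>
  have Z': "Z = (\<Sum>i=1..m. E i ** A i)"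
  proof -
    have "Z = adjoint_mat Z" using hZ by (simp add: hermitian_def)
    also have "\<dots> = (\<Sum>i=1..m. E i ** A i)"
      unfolding Z adjoint_mat_sum adjoint_mat_mult
      using hE hA by (intro sum.cong) (auto simp: hermitian_def)
    finally show ?thesis .
  qed
  have ZE: "Z ** E j = A j ** E j" if j: "j \<in> {1..m}" for j
  proof -
    have "E i ** A i ** E j = E i ** (A j ** E j)" if "i \<in> {1..m}" for i
    proof -
      have "E i ** (A i - A j) ** E j = 0" using assms(4) that j unfolding A_def by blast
      then show ?thesis
        by (simp add: matrix_diff_ldistrib matrix_diff_rdistrib matrix_mul_assoc)
    qed
    then have "Z ** E j = (\<Sum>i=1..m. E i ** (A j ** E j))"
      unfolding Z' matrix_mult_sum_left by (intro sum.cong) auto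
    also have "\<dots> = (\<Sum>i=1..m. E i) ** (A j ** E j)"
      by (simp add: matrix_mult_sum_left)
    finally show ?thesis unfolding sum_E by simp
  qed
  have Zx: "Z *v x = (\<Sum>i=1..m. A i *v (E i *v x))" for x
    by (simp add: Z matrix_vector_mult_sum_left matrix_vector_mul_assoc)
  have psd: "pos_semidef (Z - A j)" if j: "j \<in> {1..m}" for j
  proof -
    have h: "hermitian (Z - A j)" using hZ hA[OF j] by (rule hermitian_diff)
    have "0 \<le> x \<bullet> ((Z - A j) *v x)" for x
    proof -
      obtain y where y: "Z *v y = A j *v x" using pos_def_surj[OF assms(5)] .
      define u where "u = E j *v y"
      define k where "k = x - u"
      \<comment> \<open>Writes \<open>A j *v x\<close> as a family concentrated at \<open>j\<close>,
        to be compared with the decomposition of \<open>Z *v y\<close> by \<open>indep\<close>. The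
        trivial test \<open>j = j\<close> below only keeps the shape of that family.\<close>
      have "(\<Sum>i=1..m. A i *v (if i = j then x else 0)) = A j *v x"
        using j by (simp add: if_distrib cong: if_cong)
      then have "A j *v (if j = j then x else 0) = A j *v (E j *v y)"
        using y j by (intro indep) (simp_all add: Zx)
      then have Ak: "A j *v k = 0"
        by (simp add: k_def u_def matrix_vector_mult_diff_distrib)
      have Wu: "(Z - A j) *v u = 0"
        using ZE[OF j]
        by (simp add: u_def matrix_vector_mul_assoc matrix_diff_rdistrib)
      have Wx: "(Z - A j) *v x = (Z - A j) *v k"
        using Wu by (simp add: k_def matrix_vector_mult_diff_distrib)
      have "x \<bullet> ((Z - A j) *v x) = k \<bullet> ((Z - A j) *v k) + u \<bullet> ((Z - A j) *v k)"
        unfolding Wx by (simp add: k_def inner_diff_left)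
      also have "u \<bullet> ((Z - A j) *v k) = 0"
        by (simp add: hermitian_inner[OF h] Wu)
      also have "k \<bullet> ((Z - A j) *v k) = k \<bullet> (Z *v k)"
        using Ak by (simp add: matrix_vector_mult_diff_rdistrib)
      finally have "x \<bullet> ((Z - A j) *v x) = k \<bullet> (Z *v k)" by simp
      also have "\<dots> \<ge> 0"
        using assms(5) by (cases "k = 0") (auto simp: pos_def_def Re_cinner less_imp_le)
      finally show ?thesis .
    qed
    with h show ?thesis by (simp add: pos_semidef_def Re_cinner)
  qed
  \<comment> \<open>The elements of \<open>F\<close> sum to the identity, so \<open>trace Z\<close>
    can be distributed over them; all dependence on \<open>F\<close> then sits in the subtracted
    terms.\<close>
  have gap: "success_prob m p \<rho> F = Re (trace Z) - (\<Sum>i=1..m. Re (trace ((Z - A i) ** F i)))"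
    if F: "povm m F" for F
  proof -
    have "trace Z = trace (Z ** (\<Sum>i=1..m. F i))" using F by (simp add: povm_def)
    also have "\<dots> = (\<Sum>i=1..m. trace (Z ** F i))"
      by (simp add: matrix_mult_sum_right trace_sum)
    finally have "Re (trace Z) = (\<Sum>i=1..m. Re (trace (Z ** F i)))" by simp
    moreover have "success_prob m p \<rho> F = (\<Sum>i=1..m. Re (trace (A i ** F i)))"
      by (simp add: success_prob_def A_def scaleR_matrix_mult trace_def sum_distrib_left)
    ultimately show ?thesis
      by (simp add: matrix_diff_rdistrib trace_sub sum_subtractf)
  qed
  have E_val: "success_prob m p \<rho> E = Re (trace Z)"
    using ZE by (simp add: gap[OF assms(2)] matrix_diff_rdistrib trace_zero)
  have gap_nonneg: "0 \<le> Re (trace ((Z - A i) ** F i))" if "povm m F" "i \<in> {1..m}" for F i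
    using that psd by (intro trace_mult_pos_semidef_nonneg) (auto simp: povm_def)
  have "success_prob m p \<rho> F \<le> success_prob m p \<rho> E" if "povm m F" for F
  proof -
    have "0 \<le> (\<Sum>i=1..m. Re (trace ((Z - A i) ** F i)))"
      by (rule sum_nonneg) (rule gap_nonneg[OF that])
    then show ?thesis unfolding E_val gap[OF that] by linarith
  qed
  then have opt: "optimal_povm m p \<rho> E" using assms(2) by (simp add: optimal_povm_def)
  have "F i = E i" if F: "optimal_povm m p \<rho> F" and i: "i \<in> {1..m}" for F i
  proof -
    have pF: "povm m F" using F by (simp add: optimal_povm_def)
    have "success_prob m p \<rho> F = success_prob m p \<rho> E"
      using F opt by (auto simp: optimal_povm_def intro: antisym)
    then have "(\<Sum>i=1..m. Re (trace ((Z - A i) ** F i))) = 0"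
      by (simp add: gap[OF pF] E_val)
    then have "\<forall>j\<in>{1..m}. Re (trace ((Z - A j) ** F j)) = 0"
      using gap_nonneg[OF pF] by (subst (asm) sum_nonneg_eq_0_iff) auto
    then have "(Z - A j) ** F j = 0" if "j \<in> {1..m}" for j
      using that psd pF by (intro trace_mult_pos_semidef_eq_0) (auto simp: povm_def)
    then have ZF: "Z ** F j = A j ** F j" if "j \<in> {1..m}" for j
      using that by (simp add: matrix_diff_rdistrib)
    have "F i *v x = E i *v x" for x
    proof -
      have "Z *v x = (Z ** (\<Sum>j=1..m. F j)) *v x" using pF by (simp add: povm_def)
      also have "\<dots> = (\<Sum>j=1..m. A j *v (F j *v x))"
        by (simp add: matrix_mult_sum_right matrix_vector_mult_sum_left matrix_vector_mul_assoc ZF)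
      finally have "A i *v (F i *v x) = A i *v (E i *v x)"
        using i by (intro indep) (simp_all add: Zx)
      \<comment> \<open>\<open>A i\<close> may be singular and cannot be cancelled; on the ranges of
        \<open>F i\<close> and \<open>E i\<close> it agrees with the injective \<open>Z\<close>,
        which can.\<close>
      then have "Z *v (F i *v x) = Z *v (E i *v x)"
        using ZF[OF i] ZE[OF i] by (simp add: matrix_vector_mul_assoc)
      then show ?thesis by (rule pos_def_inj[OF assms(5)])
    qed
    then show ?thesis by (simp add: matrix_eq)
  qed
  with opt show ?thesis by blast
qed

end
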